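(* Let $G = (C,I)$ be a connected split graph, where $V(G)$ is partitioned into a clique $C$ and an independent set $I$. Then $\mathrm{mp}(G) = \phi(G)$.
   Context: All graphs are finite, simple and undirected. A path $P$ in $G$ is monophonic (induced) if $G$ contains no edge between vertices that are non-consecutive on $P$. A set $M \subseteq V(G)$ is a monophonic position set (mp-set) if no three vertices of $M$ lie on a common monophonic path in $G$; $\mathrm{mp}(G)$ is the number of vertices in a largest mp-set of $G$. A graph is a split graph if its vertex set can be partitioned into a clique $C$ and an independent set $I$; one writes $G=(C,I)$. For $C' \subseteq C$ and $I' \subseteq I$, the pair $(C',I')$ is a separated subgraph of $G=(C,I)$ if and only if either (Type A) there is no edge from $C'$ to $I'$ in $G$, or (Type B) there is a vertex $v \in I'$ that is adjacent to every vertex of $C'$, there are no edges from $I' \setminus \{v\}$ to $C'$, and for every $w \in I' \setminus \{v\}$ we have $N(w) \subseteq N(v)$, where $N(\cdot)$ denotes the neighbourhood in $G$. The order of $(C',I')$ is $|C'|+|I'|$, and $\phi(G)$ denotes the order of a largest separated subgraph of $G=(C,I)$. *)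

theory Defs
  imports Graph_Theory.Digraph_Component Graph_Theory.Vertex_Walk
begin

text \<open>
  Finite simple undirected graphs are the loop-free symmetric digraphs without parallel arcs of
  locale \<open>graph\<close>: the edge between u and v is the pair of arcs from u to v and
  from v to u, so adjacency is \<open>u \<rightarrow>\<^bsub>G\<^esub> v\<close>.
\<close>

definition neighbourhood :: "('a, 'b) pre_digraph \<Rightarrow> 'a \<Rightarrow> 'a set" where
  "neighbourhood G v = {w \<in> verts G. v \<rightarrow>\<^bsub>G\<^esub> w}"

text \<open>A path is given by the list of its (distinct) vertices; it may consist of a single vertex.\<close>

definition monophonic_path :: "('a, 'b) pre_digraph \<Rightarrow> 'a list \<Rightarrow> bool" where
  "monophonic_path G p \<longleftrightarrow>
     vpath p G \<and>
     (\<forall>i < length p. \<forall>j < length p.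
        j \<noteq> Suc i \<and> i \<noteq> Suc j \<longrightarrow> \<not> p ! i \<rightarrow>\<^bsub>G\<^esub> p ! j)"

definition mp_set :: "('a, 'b) pre_digraph \<Rightarrow> 'a set \<Rightarrow> bool" where
  "mp_set G M \<longleftrightarrow>
     M \<subseteq> verts G \<and>
     \<not> (\<exists>x \<in> M. \<exists>y \<in> M. \<exists>z \<in> M. x \<noteq> y \<and> y \<noteq> z \<and> x \<noteq> z \<and>
         (\<exists>p. monophonic_path G p \<and> {x, y, z} \<subseteq> set p))"

definition mp_number :: "('a, 'b) pre_digraph \<Rightarrow> nat" where
  "mp_number G = Max (card ` {M. mp_set G M})"

definition clique :: "('a, 'b) pre_digraph \<Rightarrow> 'a set \<Rightarrow> bool" where
  "clique G C \<longleftrightarrow> C \<subseteq> verts G \<and> (\<forall>u \<in> C. \<forall>v \<in> C. u \<noteq> v \<longrightarrow> u \<rightarrow>\<^bsub>G\<^esub> v)"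

definition independent :: "('a, 'b) pre_digraph \<Rightarrow> 'a set \<Rightarrow> bool" where
  "independent G I \<longleftrightarrow> I \<subseteq> verts G \<and> (\<forall>u \<in> I. \<forall>v \<in> I. \<not> u \<rightarrow>\<^bsub>G\<^esub> v)"

text \<open>Either part of the partition may be empty.\<close>

definition split_partition :: "('a, 'b) pre_digraph \<Rightarrow> 'a set \<Rightarrow> 'a set \<Rightarrow> bool" where
  "split_partition G C I \<longleftrightarrow>
     C \<union> I = verts G \<and> C \<inter> I = {} \<and> clique G C \<and> independent G I"

definition separated_type_A :: "('a, 'b) pre_digraph \<Rightarrow> 'a set \<Rightarrow> 'a set \<Rightarrow> bool" where
  "separated_type_A G C' I' \<longleftrightarrow> (\<forall>c \<in> C'. \<forall>w \<in> I'. \<not> c \<rightarrow>\<^bsub>G\<^esub> w)"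

definition separated_type_B :: "('a, 'b) pre_digraph \<Rightarrow> 'a set \<Rightarrow> 'a set \<Rightarrow> bool" where
  "separated_type_B G C' I' \<longleftrightarrow>
     (\<exists>v \<in> I'.
        (\<forall>c \<in> C'. v \<rightarrow>\<^bsub>G\<^esub> c) \<and>
        (\<forall>w \<in> I' - {v}. \<forall>c \<in> C'. \<not> w \<rightarrow>\<^bsub>G\<^esub> c) \<and>
        (\<forall>w \<in> I' - {v}. neighbourhood G w \<subseteq> neighbourhood G v))"

definition separated_subgraph ::
  "('a, 'b) pre_digraph \<Rightarrow> 'a set \<Rightarrow> 'a set \<Rightarrow> 'a set \<Rightarrow> 'a set \<Rightarrow> bool" where
  "separated_subgraph G C I C' I' \<longleftrightarrow>
     C' \<subseteq> C \<and> I' \<subseteq> I \<and> (separated_type_A G C' I' \<or> separated_type_B G C' I')"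

text \<open>The split partition is an argument, since a split graph may have several of them.\<close>

definition phi :: "('a, 'b) pre_digraph \<Rightarrow> 'a set \<Rightarrow> 'a set \<Rightarrow> nat" where
  "phi G C I = Max {card C' + card I' | C' I'. separated_subgraph G C I C' I'}"

text \<open>For a graph, both maxima range over finite nonempty sets.\<close>

lemma (in graph) mp_number_well_defined:
  "finite (card ` {M. mp_set G M})" "card ` {M. mp_set G M} \<noteq> {}"
proof -
  have "{M. mp_set G M} \<subseteq> Pow (verts G)" by (auto simp: mp_set_def)
  then show "finite (card ` {M. mp_set G M})"
    by (meson finite_Pow_iff finite_imageI finite_subset finite_verts)
  have "mp_set G {}" by (simp add: mp_set_def)
  then show "card ` {M. mp_set G M} \<noteq> {}" by blast
qed

lemma (in graph) phi_well_defined: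
  assumes "split_partition G C I"
  shows "finite {card C' + card I' | C' I'. separated_subgraph G C I C' I'}"
    and "{card C' + card I' | C' I'. separated_subgraph G C I C' I'} \<noteq> {}"
proof -
  have fin: "finite (Pow C \<times> Pow I)"
    using assms finite_verts by (metis finite_Pow_iff finite_SigmaI finite_Un split_partition_def)
  have "{card C' + card I' | C' I'. separated_subgraph G C I C' I'}
      \<subseteq> (\<lambda>(X, Y). card X + card Y) ` (Pow C \<times> Pow I)"
    by (auto simp: separated_subgraph_def)
  then show "finite {card C' + card I' | C' I'. separated_subgraph G C I C' I'}"
    using fin by (meson finite_imageI finite_subset)
  have "separated_subgraph G C I {} {}"
    by (simp add: separated_subgraph_def separated_type_A_def)
  then show "{card C' + card I' | C' I'. separated_subgraph G C I C' I'} \<noteq> {}" by blast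
qed

end

theory Submission
  imports Defs
begin

text \<open>
  Interior vertices of a monophonic path lie in the clique, because the two path-neighbours of a
  vertex of the independent set would be non-adjacent members of the clique. So a monophonic path
  on at least three vertices has the form \<open>a b c\<close> or \<open>a b c d\<close>, and any three of its vertices
  include an edge between the clique and the independent set. Such a path through three vertices of
  a set M exists exactly when some edge between the two parts of M violates the condition of Type B.
  Hence the mp-sets are exactly the sets whose two parts form a separated subgraph.
\<close>

lemma vwalk_nth_adj:
  assumes "vwalk p G" "Suc i < length p"
  shows "p ! i \<rightarrow>\<^bsub>G\<^esub> p ! Suc i"
proof -
  have "(p ! i, p ! Suc i) \<in> set (vwalk_arcs p)"
    using assms(2)
  proof (induction p arbitrary: i rule: vwalk_arcs.induct)
    case (3 x y xs)
    then show ?case by (cases i) auto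
  qed auto
  then show ?thesis using assms(1) by (auto simp: vwalk_def)
qed

context graph
begin

lemma adj_sym: "u \<rightarrow>\<^bsub>G\<^esub> v \<longleftrightarrow> v \<rightarrow>\<^bsub>G\<^esub> u"
  using sym_arcs by (auto simp: symmetric_def dest: symD)

lemma adj_irrefl: "\<not> u \<rightarrow>\<^bsub>G\<^esub> u"
  using adj_not_same by blast

text \<open>Only the ends need an explicit inequality, since adjacency already forces consecutive
  vertices to differ.\<close>

lemma monophonic_path3_iff:
  "monophonic_path G [a, b, c] \<longleftrightarrow>
     a \<rightarrow>\<^bsub>G\<^esub> b \<and> b \<rightarrow>\<^bsub>G\<^esub> c \<and> \<not> a \<rightarrow>\<^bsub>G\<^esub> c \<and> a \<noteq> c"
  by (auto simp: monophonic_path_def vpath_def vwalk_def All_less_Suc adj_irrefl adj_sym[of c a]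
      dest: adj_in_verts)

lemma monophonic_path4_iff:
  "monophonic_path G [a, b, c, d] \<longleftrightarrow>
     a \<rightarrow>\<^bsub>G\<^esub> b \<and> b \<rightarrow>\<^bsub>G\<^esub> c \<and> c \<rightarrow>\<^bsub>G\<^esub> d \<and>
     \<not> a \<rightarrow>\<^bsub>G\<^esub> c \<and> \<not> a \<rightarrow>\<^bsub>G\<^esub> d \<and> \<not> b \<rightarrow>\<^bsub>G\<^esub> d \<and>
     a \<noteq> c \<and> a \<noteq> d \<and> b \<noteq> d"
  by (auto simp: monophonic_path_def vpath_def vwalk_def All_less_Suc adj_irrefl
      adj_sym[of c a] adj_sym[of d a] adj_sym[of d b] dest: adj_in_verts)

lemma split_adj_not_independent:
  assumes "split_partition G C I" "u \<rightarrow>\<^bsub>G\<^esub> v" "u \<in> I"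
  shows "v \<in> C"
  using assms adj_in_verts(2)[OF assms(2)]
  by (auto simp: split_partition_def independent_def)

lemma monophonic_path_interior_clique:
  assumes sp: "split_partition G C I" and p: "monophonic_path G p" and n: "Suc (Suc n) < length p"
  shows "p ! Suc n \<in> C"
proof (rule ccontr)
  assume "p ! Suc n \<notin> C"
  have path: "vpath p G" using p by (simp add: monophonic_path_def)
  then have "p ! Suc n \<in> verts G"
    using n by (auto simp: vpath_def vwalk_def)
  then have I: "p ! Suc n \<in> I"
    using sp \<open>p ! Suc n \<notin> C\<close> by (auto simp: split_partition_def)
  have adj: "p ! i \<rightarrow>\<^bsub>G\<^esub> p ! Suc i" if "Suc i < length p" for i
    using vwalk_nth_adj path that by (auto simp: vpath_def)
  have "p ! n \<in> C" "p ! Suc (Suc n) \<in> C"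
    using split_adj_not_independent[OF sp _ I] adj[of n] adj[of "Suc n"] n
      adj_sym[of "p ! n"] by simp_all
  moreover have "p ! n \<noteq> p ! Suc (Suc n)"
    using path n by (simp add: vpath_def nth_eq_iff_index_eq)
  ultimately have "p ! n \<rightarrow>\<^bsub>G\<^esub> p ! Suc (Suc n)"
    using sp by (auto simp: split_partition_def clique_def)
  then show False
    using p n by (auto simp: monophonic_path_def)
qed

text \<open>With five or more vertices, positions 1 and 3 would both be interior, hence in
  \<open>C\<close> and adjacent without being consecutive. The ends may lie in either part.\<close>

lemma monophonic_path_split_cases:
  assumes sp: "split_partition G C I" and p: "monophonic_path G p" and len: "3 \<le> length p"
  obtains a b c where "p = [a, b, c]" "b \<in> C"
  | a b c d where "p = [a, b, c, d]" "b \<in> C" "c \<in> C"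
proof -
  have "length p < 5"
  proof (rule ccontr)
    assume "\<not> length p < 5"
    then have "p ! 1 \<in> C" "p ! 3 \<in> C" and l: "3 < length p"
      using monophonic_path_interior_clique[OF sp p, of 0]
        monophonic_path_interior_clique[OF sp p, of 2] by (auto simp: numeral_3_eq_3 numeral_2_eq_2)
    moreover have "p ! 1 \<noteq> p ! 3"
      using p l by (simp add: monophonic_path_def vpath_def nth_eq_iff_index_eq)
    ultimately have "p ! 1 \<rightarrow>\<^bsub>G\<^esub> p ! 3"
      using sp by (auto simp: split_partition_def clique_def)
    then show False
      using p l by (auto simp: monophonic_path_def)
  qed
  then consider "length p = 3" | "length p = 4" using len by linarith
  then show thesis
  proof cases
    case 1
    then obtain a b c where "p = [a, b, c]"
      by (auto simp: numeral_3_eq_3 length_Suc_conv)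
    then show thesis
      using that(1) monophonic_path_interior_clique[OF sp p, of 0] by simp
  next
    case 2
    then obtain a b c d where "p = [a, b, c, d]"
      by (auto simp: numeral_eq_Suc length_Suc_conv)
    then show thesis
      using that(2) monophonic_path_interior_clique[OF sp p, of 0]
        monophonic_path_interior_clique[OF sp p, of 1] by simp
  qed
qed

lemma mp_set_imp_separated:
  assumes sp: "split_partition G C I" and M: "mp_set G M"
  shows "separated_subgraph G C I (M \<inter> C) (M \<inter> I)"
proof (cases "separated_type_A G (M \<inter> C) (M \<inter> I)")
  case True
  then show ?thesis by (simp add: separated_subgraph_def)
next
  case False
  \<comment> \<open>The end \<open>v\<close> of this edge will be the distinguished vertex of Type
    B. Each condition of Type B, if it failed, would give a monophonic path through \<open>v\<close>
    and two further vertices of \<open>M\<close>.\<close>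
  then obtain c v where c: "c \<in> M" "c \<in> C" and v: "v \<in> M" "v \<in> I" and cv: "c \<rightarrow>\<^bsub>G\<^esub> v"
    by (auto simp: separated_type_A_def)
  have vc: "v \<rightarrow>\<^bsub>G\<^esub> c" using cv adj_sym by blast
  have disj: "C \<inter> I = {}" and cl: "\<And>u w. u \<in> C \<Longrightarrow> w \<in> C \<Longrightarrow> u \<noteq> w \<Longrightarrow> u \<rightarrow>\<^bsub>G\<^esub> w"
    and ind: "\<And>u w. u \<in> I \<Longrightarrow> w \<in> I \<Longrightarrow> \<not> u \<rightarrow>\<^bsub>G\<^esub> w"
    using sp by (auto simp: split_partition_def clique_def independent_def)
  have no: False if "monophonic_path G p" "{x, y, z} \<subseteq> set p" "x \<in> M" "y \<in> M" "z \<in> M"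
    "x \<noteq> y" "y \<noteq> z" "x \<noteq> z" for p x y z
    using M that unfolding mp_set_def by blast
  have all: "v \<rightarrow>\<^bsub>G\<^esub> c'" if "c' \<in> M \<inter> C" for c'
  proof (rule ccontr)
    assume n: "\<not> v \<rightarrow>\<^bsub>G\<^esub> c'"
    then have "monophonic_path G [v, c, c']"
      using that c v vc disj cl[of c c'] by (auto simp: monophonic_path3_iff)
    then show False
      using no[of "[v, c, c']" v c c'] that c v n vc disj by auto
  qed
  \<comment> \<open>By \<open>all\<close>, \<open>c'\<close> is adjacent to \<open>v\<close> as
    well, so it would join the non-adjacent vertices \<open>v\<close> and \<open>w\<close>.\<close>
  have none: "\<not> w \<rightarrow>\<^bsub>G\<^esub> c'" if w: "w \<in> M \<inter> I - {v}" and c': "c' \<in> M \<inter> C" for w c'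
  proof
    assume "w \<rightarrow>\<^bsub>G\<^esub> c'"
    then have "monophonic_path G [v, c', w]"
      using w v all[OF c'] ind[of v w] adj_sym[of w c'] by (auto simp: monophonic_path3_iff)
    then show False
      using no[of "[v, c', w]" v c' w] w v c' disj by auto
  qed
  have "neighbourhood G w \<subseteq> neighbourhood G v" if w: "w \<in> M \<inter> I - {v}" for w
  proof (rule ccontr)
    assume "\<not> ?thesis"
    \<comment> \<open>The vertex \<open>d\<close> need not belong to \<open>M\<close>: on the path
      \<open>v c d w\<close>, the three vertices \<open>v\<close>, \<open>c\<close> and
      \<open>w\<close> already do.\<close>
    then obtain d where d: "w \<rightarrow>\<^bsub>G\<^esub> d" "\<not> v \<rightarrow>\<^bsub>G\<^esub> d"
      by (auto simp: neighbourhood_def)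
    have "d \<in> C" using split_adj_not_independent[OF sp d(1)] w by auto
    moreover have "d \<noteq> c" using vc d by auto
    moreover have "\<not> c \<rightarrow>\<^bsub>G\<^esub> w" using none[OF w] c adj_sym by blast
    moreover have "d \<rightarrow>\<^bsub>G\<^esub> w" using d(1) adj_sym by blast
    ultimately have "monophonic_path G [v, c, d, w]"
      using w v c vc d(2) disj ind[of v w] cl[of c d] by (auto simp: monophonic_path4_iff)
    then show False
      using no[of "[v, c, d, w]" v c w] w v c disj by auto
  qed
  then have "separated_type_B G (M \<inter> C) (M \<inter> I)"
    unfolding separated_type_B_def using v all none by (intro bexI[of _ v]) auto
  then show ?thesis by (simp add: separated_subgraph_def)
qed

text \<open>Three vertices of a monophonic path include an edge between the parts, and such an edge
  fixes the distinguished vertex of Type B. The properties of that vertex then produce a chord or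
  forbid an edge of the path.\<close>

lemma separated_imp_no_path_triple:
  assumes sp: "split_partition G C I" and sep: "separated_subgraph G C I C' I'"
    and p: "monophonic_path G p" and xyz: "{x, y, z} \<subseteq> set p" "{x, y, z} \<subseteq> C' \<union> I'"
    and ne: "x \<noteq> y" "y \<noteq> z" "x \<noteq> z"
  shows False
proof -
  have verts: "C \<union> I = verts G" and disj: "C \<inter> I = {}"
    and cl: "\<And>u w. u \<in> C \<Longrightarrow> w \<in> C \<Longrightarrow> u \<noteq> w \<Longrightarrow> u \<rightarrow>\<^bsub>G\<^esub> w"
    using sp by (auto simp: split_partition_def clique_def)
  have sub: "C' \<subseteq> C" "I' \<subseteq> I" using sep by (auto simp: separated_subgraph_def)
  \<comment> \<open>Type A has no such edge. In Type B the vertex \<open>w\<close> must be the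
    distinguished one, as the others have no neighbour in \<open>C'\<close>.\<close>
  have edge: "(\<forall>u\<in>C'. w \<rightarrow>\<^bsub>G\<^esub> u) \<and>
      (\<forall>i\<in>I' - {w}. (\<forall>u\<in>C'. \<not> i \<rightarrow>\<^bsub>G\<^esub> u) \<and> neighbourhood G i \<subseteq> neighbourhood G w)"
    if "w \<in> I'" "u \<in> C'" "w \<rightarrow>\<^bsub>G\<^esub> u" for u w
    using sep that adj_sym
    unfolding separated_subgraph_def separated_type_A_def separated_type_B_def by blast
  have nbr: "w \<rightarrow>\<^bsub>G\<^esub> d"
    if "w \<in> I'" "u \<in> C'" "w \<rightarrow>\<^bsub>G\<^esub> u" "i \<in> I'" "i \<rightarrow>\<^bsub>G\<^esub> d" for w u i d
    using edge[OF that(1-3)] that(4,5) adj_in_verts(2)[OF that(5)]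
    by (cases "i = w") (auto simp: neighbourhood_def)
  have "card {x, y, z} \<le> length p"
    using xyz(1) by (meson List.finite_set card_length card_mono le_trans)
  then have "3 \<le> length p" using ne by simp
  with sp p show False
  proof (cases rule: monophonic_path_split_cases)
    case (1 a b c)
    then have P: "a \<rightarrow>\<^bsub>G\<^esub> b" "c \<rightarrow>\<^bsub>G\<^esub> b" "\<not> a \<rightarrow>\<^bsub>G\<^esub> c" "\<not> c \<rightarrow>\<^bsub>G\<^esub> a" "a \<noteq> c"
      using p monophonic_path3_iff adj_sym by blast+
    have "{a, b, c} \<subseteq> C' \<union> I'" using xyz ne 1 by auto
    then have "b \<in> C'" "a \<in> C' \<union> I'" "c \<in> C' \<union> I'" using 1 sub disj by auto
    \<comment> \<open>So one end lies in \<open>I'\<close> and is distinguished by its edge to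
      \<open>b\<close>. The other end would be adjacent to it if in \<open>C'\<close>, and not
      adjacent to \<open>b\<close> if in \<open>I'\<close>.\<close>
    moreover have "a \<notin> C' \<or> c \<notin> C'" using cl[of a c] P sub by auto
    ultimately show False using edge[of a b] edge[of c b] P by blast
  next
    case (2 a b c d)
    then have P: "a \<rightarrow>\<^bsub>G\<^esub> b" "d \<rightarrow>\<^bsub>G\<^esub> c" "\<not> a \<rightarrow>\<^bsub>G\<^esub> c" "\<not> d \<rightarrow>\<^bsub>G\<^esub> b" "a \<noteq> c" "d \<noteq> b"
      using p monophonic_path4_iff adj_sym by blast+
    \<comment> \<open>Each end is non-adjacent to the inner vertex farther from it, which lies in
      the clique.\<close>
    have ad: "a \<notin> C" "d \<notin> C" using cl P 2 by blast+
    \<comment> \<open>Three of the four vertices are either both inner ones with an end, or both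
      ends with an inner one.\<close>
    have "{b, c} \<subseteq> C' \<union> I' \<and> (a \<in> C' \<union> I' \<or> d \<in> C' \<union> I') \<or>
        {a, d} \<subseteq> C' \<union> I' \<and> (b \<in> C' \<union> I' \<or> c \<in> C' \<union> I')"
      using xyz ne 2 by auto
    then have "{b, c} \<subseteq> C' \<and> (a \<in> I' \<or> d \<in> I') \<or> {a, d} \<subseteq> I' \<and> (b \<in> C' \<or> c \<in> C')"
      using ad 2 sub disj by blast
    \<comment> \<open>In the first case \<open>edge\<close> gives the chord \<open>a c\<close> or
      \<open>d b\<close>, because the end in \<open>I'\<close> is adjacent to all of
      \<open>C'\<close>. In the second, \<open>nbr\<close> gives the same chords by passing the
      other end's inner neighbour to the distinguished end.\<close>
    then show False
      using edge[of a b] edge[of d c] nbr[of a b d c] nbr[of d c a b] P by blast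
  qed
qed

lemma separated_imp_mp_set:
  assumes sp: "split_partition G C I" and sep: "separated_subgraph G C I C' I'"
  shows "mp_set G (C' \<union> I')"
  unfolding mp_set_def
proof (intro conjI notI)
  show "C' \<union> I' \<subseteq> verts G"
    using sp sep by (auto simp: split_partition_def separated_subgraph_def)
next
  assume "\<exists>x\<in>C' \<union> I'. \<exists>y\<in>C' \<union> I'. \<exists>z\<in>C' \<union> I'. x \<noteq> y \<and> y \<noteq> z \<and> x \<noteq> z \<and>
    (\<exists>p. monophonic_path G p \<and> {x, y, z} \<subseteq> set p)"
  then obtain x y z p where "monophonic_path G p" "{x, y, z} \<subseteq> set p" "{x, y, z} \<subseteq> C' \<union> I'"
    "x \<noteq> y" "y \<noteq> z" "x \<noteq> z"
    by blast
  then show False by (rule separated_imp_no_path_triple[OF sp sep])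
qed

text \<open>Splitting \<open>M\<close> along the partition and taking the union of a pair both
  preserve size. The two maxima therefore range over the same set of numbers.\<close>

lemma mp_set_cards_eq_separated_orders:
  assumes sp: "split_partition G C I"
  shows "card ` {M. mp_set G M} = {card C' + card I' | C' I'. separated_subgraph G C I C' I'}"
proof -
  have parts: "C \<union> I = verts G" and disj: "C \<inter> I = {}"
    using sp by (auto simp: split_partition_def)
  have fin: "finite C" "finite I"
    using finite_verts unfolding parts[symmetric] by auto
  have card: "card (C' \<union> I') = card C' + card I'" if "C' \<subseteq> C" "I' \<subseteq> I" for C' I'
    using that fin disj by (meson card_Un_disjoint disjoint_iff finite_subset subsetD)
  have split: "M = M \<inter> C \<union> M \<inter> I" if "mp_set G M" for M
    using that sp by (auto simp: mp_set_def split_partition_def)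
  show ?thesis
  proof (intro equalityI subsetI)
    fix n assume "n \<in> card ` {M. mp_set G M}"
    then obtain M where M: "mp_set G M" "n = card M" by blast
    then have "n = card (M \<inter> C) + card (M \<inter> I)"
      using split[OF M(1)] card[of "M \<inter> C" "M \<inter> I"] by simp
    then show "n \<in> {card C' + card I' | C' I'. separated_subgraph G C I C' I'}"
      using mp_set_imp_separated[OF sp M(1)] by blast
  next
    fix n assume "n \<in> {card C' + card I' | C' I'. separated_subgraph G C I C' I'}"
    then obtain C' I' where "separated_subgraph G C I C' I'" "n = card (C' \<union> I')"
      using card by (auto simp: separated_subgraph_def)
    then show "n \<in> card ` {M. mp_set G M}"
      using separated_imp_mp_set[OF sp] by blast
  qed
qed

end

theorem theorem4p6:
  fixes G :: "('a, 'b) pre_digraph" and C I :: "'a set"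
  assumes "graph G"
    and "Digraph_Component.connected G"
    and "split_partition G C I"
  shows "mp_number G = phi G C I"
  using graph.mp_set_cards_eq_separated_orders[OF assms(1,3)]
  by (simp add: mp_number_def phi_def)

end
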